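(* Let $(\mathcal{C}, C)$ be a (strict) braided tensor category and let $X$, $A$ and $H$ be bialgebras (respectively, Hopf algebras) in $\mathcal{C}$. Let $p_A : X \to A$ and $p_H : X \to H$ be bialgebra (respectively, Hopf algebra) morphisms in $\mathcal{C}$. If $\xi := (p_A \otimes p_H)\Delta_X : X \to A \otimes H$ is an isomorphism of objects in $\mathcal{C}$, then there exist morphisms $$\phi : A \to H \otimes A \quad\text{and}\quad \psi : H \to H \otimes A$$ in $\mathcal{C}$ such that $A\,{}^{\phi}\!\bowtie^{\psi} H$ becomes a bialgebra (respectively, Hopf algebra) in $\mathcal{C}$ and $\xi$ is a bialgebra (respectively, Hopf algebra) isomorphism from $X$ to $A\,{}^{\phi}\!\bowtie^{\psi} H$.
   Context: Bialgebras and Hopf algebras are understood inside the braided tensor category $(\mathcal{C}, C)$, where $C_{U,V} : U\otimes V \to V \otimes U$ is the braiding; the tensor product is treated as strict. Double cross coproduct: for bialgebras $A, H$ in $\mathcal{C}$ and morphisms $\phi : A \to H\otimes A$, $\psi : H \to H \otimes A$ in $\mathcal{C}$, $A\,{}^{\phi}\!\bowtie^{\psi} H$ denotes the object $D = A \otimes H$ equipped with $$m_D = (m_A \otimes m_H)(\mathrm{id}_A \otimes C_{H,A} \otimes \mathrm{id}_H),\qquad \eta_D = \eta_A \otimes \eta_H,$$ $$\Delta_D = (\mathrm{id}_A \otimes m_H \otimes m_A \otimes \mathrm{id}_H)(\mathrm{id}_A \otimes \mathrm{id}_H \otimes C_{A,H} \otimes \mathrm{id}_A \otimes \mathrm{id}_H)(\mathrm{id}_A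 \otimes \phi \otimes \psi \otimes \mathrm{id}_H)(\Delta_A \otimes \Delta_H),\qquad \epsilon_D = \epsilon_A \otimes \epsilon_H.$$ *)

theory Defs
  imports Main
begin

section \<open>Strict braided tensor categories\<close>

text \<open>
  Composition is written in the usual order: \<open>g \<cdot> f\<close> means first \<open>f\<close>, then \<open>g\<close>.
  The tensor product is \<open>\<boxtimes>\<close> on objects and \<open>\<otimes>\<close> on morphisms; \<open>\<beta> U V\<close> is the
  braiding \<open>U \<boxtimes> V \<rightarrow> V \<boxtimes> U\<close>.
\<close>

record ('o, 'a) cat =
  Obj :: "'o set"
  Arr :: "'a set"
  Dom :: "'a \<Rightarrow> 'o"
  Cod :: "'a \<Rightarrow> 'o"
  Ident :: "'o \<Rightarrow> 'a" ("\<one>\<index>")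
  Comp :: "'a \<Rightarrow> 'a \<Rightarrow> 'a" (infixr "\<cdot>\<index>" 70)

record ('o, 'a) monoidal_cat = "('o, 'a) cat" +
  tensor_obj :: "'o \<Rightarrow> 'o \<Rightarrow> 'o" (infixr "\<boxtimes>\<index>" 75)
  tensor_arr :: "'a \<Rightarrow> 'a \<Rightarrow> 'a" (infixr "\<otimes>\<index>" 75)
  unit_obj :: "'o" ("\<I>\<index>")

record ('o, 'a) braided_cat = "('o, 'a) monoidal_cat" +
  braiding :: "'o \<Rightarrow> 'o \<Rightarrow> 'a" ("\<beta>\<index>")

definition hom :: "('o, 'a, 'z) cat_scheme \<Rightarrow> 'o \<Rightarrow> 'o \<Rightarrow> 'a set" where
  "hom C U V = {f \<in> Arr C. Dom C f = U \<and> Cod C f = V}"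

locale category =
  fixes C :: "('o, 'a, 'z) cat_scheme" (structure)
  assumes dom_in_Obj: "f \<in> Arr C \<Longrightarrow> Dom C f \<in> Obj C"
    and cod_in_Obj: "f \<in> Arr C \<Longrightarrow> Cod C f \<in> Obj C"
    and ident_in_hom: "U \<in> Obj C \<Longrightarrow> \<one> U \<in> hom C U U"
    and comp_in_hom: "\<lbrakk>f \<in> hom C U V; g \<in> hom C V W\<rbrakk> \<Longrightarrow> g \<cdot> f \<in> hom C U W"
    and comp_ident: "f \<in> hom C U V \<Longrightarrow> f \<cdot> \<one> U = f"
    and ident_comp: "f \<in> hom C U V \<Longrightarrow> \<one> V \<cdot> f = f"
    and comp_assoc: "\<lbrakk>f \<in> hom C U V; g \<in> hom C V W; h \<in> hom C W Y\<rbrakk>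
      \<Longrightarrow> (h \<cdot> g) \<cdot> f = h \<cdot> (g \<cdot> f)"

definition inverse_arrows ::
  "('o, 'a, 'z) cat_scheme \<Rightarrow> 'o \<Rightarrow> 'o \<Rightarrow> 'a \<Rightarrow> 'a \<Rightarrow> bool" where
  "inverse_arrows C U V f g \<longleftrightarrow>
     f \<in> hom C U V \<and> g \<in> hom C V U \<and>
     g \<cdot>\<^bsub>C\<^esub> f = \<one>\<^bsub>C\<^esub> U \<and> f \<cdot>\<^bsub>C\<^esub> g = \<one>\<^bsub>C\<^esub> V"

definition iso_arrow :: "('o, 'a, 'z) cat_scheme \<Rightarrow> 'o \<Rightarrow> 'o \<Rightarrow> 'a \<Rightarrow> bool" where
  "iso_arrow C U V f \<longleftrightarrow> (\<exists>g. inverse_arrows C U V f g)"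

locale strict_tensor_category = category C
  for C :: "('o, 'a, 'z) monoidal_cat_scheme" (structure) +
  assumes unit_in_Obj: "\<I> \<in> Obj C"
    and tensor_in_Obj: "\<lbrakk>U \<in> Obj C; V \<in> Obj C\<rbrakk> \<Longrightarrow> U \<boxtimes> V \<in> Obj C"
    and tensor_in_hom: "\<lbrakk>f \<in> hom C U U'; g \<in> hom C V V'\<rbrakk>
      \<Longrightarrow> f \<otimes> g \<in> hom C (U \<boxtimes> V) (U' \<boxtimes> V')"
    and tensor_ident: "\<lbrakk>U \<in> Obj C; V \<in> Obj C\<rbrakk> \<Longrightarrow> \<one> U \<otimes> \<one> V = \<one> (U \<boxtimes> V)"
    and interchange:
      "\<lbrakk>f \<in> hom C U U'; f' \<in> hom C U' U''; g \<in> hom C V V'; g' \<in> hom C V' V''\<rbrakk>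
      \<Longrightarrow> (f' \<cdot> f) \<otimes> (g' \<cdot> g) = (f' \<otimes> g') \<cdot> (f \<otimes> g)"
    and tensor_obj_assoc: "\<lbrakk>U \<in> Obj C; V \<in> Obj C; W \<in> Obj C\<rbrakk>
      \<Longrightarrow> (U \<boxtimes> V) \<boxtimes> W = U \<boxtimes> (V \<boxtimes> W)"
    and tensor_arr_assoc: "\<lbrakk>f \<in> Arr C; g \<in> Arr C; h \<in> Arr C\<rbrakk>
      \<Longrightarrow> (f \<otimes> g) \<otimes> h = f \<otimes> (g \<otimes> h)"
    and unit_tensor_obj: "U \<in> Obj C \<Longrightarrow> \<I> \<boxtimes> U = U"
    and tensor_unit_obj: "U \<in> Obj C \<Longrightarrow> U \<boxtimes> \<I> = U"
    and unit_tensor_arr: "f \<in> Arr C \<Longrightarrow> \<one> \<I> \<otimes> f = f"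
    and tensor_unit_arr: "f \<in> Arr C \<Longrightarrow> f \<otimes> \<one> \<I> = f"

text \<open>
  The last two axioms are the hexagon identities, in which the associativity
  constraints are identities.
\<close>

locale strict_braided_tensor_category = strict_tensor_category C
  for C :: "('o, 'a, 'z) braided_cat_scheme" (structure) +
  assumes braiding_iso: "\<lbrakk>U \<in> Obj C; V \<in> Obj C\<rbrakk>
      \<Longrightarrow> iso_arrow C (U \<boxtimes> V) (V \<boxtimes> U) (\<beta> U V)"
    and braiding_natural: "\<lbrakk>f \<in> hom C U U'; g \<in> hom C V V'\<rbrakk>
      \<Longrightarrow> \<beta> U' V' \<cdot> (f \<otimes> g) = (g \<otimes> f) \<cdot> \<beta> U V"
    and hexagon_right: "\<lbrakk>U \<in> Obj C; V \<in> Obj C; W \<in> Obj C\<rbrakk>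
      \<Longrightarrow> \<beta> U (V \<boxtimes> W) = (\<one> V \<otimes> \<beta> U W) \<cdot> (\<beta> U V \<otimes> \<one> W)"
    and hexagon_left: "\<lbrakk>U \<in> Obj C; V \<in> Obj C; W \<in> Obj C\<rbrakk>
      \<Longrightarrow> \<beta> (U \<boxtimes> V) W = (\<beta> U W \<otimes> \<one> V) \<cdot> (\<one> U \<otimes> \<beta> V W)"


section \<open>Bialgebras and Hopf algebras in a braided tensor category\<close>

record ('o, 'a) bialg =
  object :: "'o"
  mult :: "'a"
  unit :: "'a"
  comult :: "'a"
  counit :: "'a"

record ('o, 'a) hopf_alg = "('o, 'a) bialg" +
  antipode :: "'a"

definition algebra_in ::
  "('o, 'a, 'z) monoidal_cat_scheme \<Rightarrow> ('o, 'a, 'y) bialg_scheme \<Rightarrow> bool" where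
  "algebra_in C B \<longleftrightarrow> (let U = object B; m = mult B; u = unit B in
     U \<in> Obj C \<and> m \<in> hom C (U \<boxtimes>\<^bsub>C\<^esub> U) U \<and> u \<in> hom C \<I>\<^bsub>C\<^esub> U \<and>
     m \<cdot>\<^bsub>C\<^esub> (m \<otimes>\<^bsub>C\<^esub> \<one>\<^bsub>C\<^esub> U) = m \<cdot>\<^bsub>C\<^esub> (\<one>\<^bsub>C\<^esub> U \<otimes>\<^bsub>C\<^esub> m) \<and>
     m \<cdot>\<^bsub>C\<^esub> (u \<otimes>\<^bsub>C\<^esub> \<one>\<^bsub>C\<^esub> U) = \<one>\<^bsub>C\<^esub> U \<and>
     m \<cdot>\<^bsub>C\<^esub> (\<one>\<^bsub>C\<^esub> U \<otimes>\<^bsub>C\<^esub> u) = \<one>\<^bsub>C\<^esub> U)"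

definition coalgebra_in ::
  "('o, 'a, 'z) monoidal_cat_scheme \<Rightarrow> ('o, 'a, 'y) bialg_scheme \<Rightarrow> bool" where
  "coalgebra_in C B \<longleftrightarrow> (let U = object B; d = comult B; e = counit B in
     U \<in> Obj C \<and> d \<in> hom C U (U \<boxtimes>\<^bsub>C\<^esub> U) \<and> e \<in> hom C U \<I>\<^bsub>C\<^esub> \<and>
     (d \<otimes>\<^bsub>C\<^esub> \<one>\<^bsub>C\<^esub> U) \<cdot>\<^bsub>C\<^esub> d = (\<one>\<^bsub>C\<^esub> U \<otimes>\<^bsub>C\<^esub> d) \<cdot>\<^bsub>C\<^esub> d \<and>
     (e \<otimes>\<^bsub>C\<^esub> \<one>\<^bsub>C\<^esub> U) \<cdot>\<^bsub>C\<^esub> d = \<one>\<^bsub>C\<^esub> U \<and>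
     (\<one>\<^bsub>C\<^esub> U \<otimes>\<^bsub>C\<^esub> e) \<cdot>\<^bsub>C\<^esub> d = \<one>\<^bsub>C\<^esub> U)"

text \<open>
  The four equations say that comultiplication and counit are algebra morphisms, where
  \<open>U \<boxtimes> U\<close> carries the multiplication \<open>(m \<otimes> m) \<cdot> (\<one> U \<otimes> \<beta> U U \<otimes> \<one> U)\<close>; since \<open>\<I> \<boxtimes> \<I> = \<I>\<close>,
  both \<open>u \<otimes> u\<close> and \<open>e \<otimes> e\<close> have the required type.
\<close>

definition bialgebra_in ::
  "('o, 'a, 'z) braided_cat_scheme \<Rightarrow> ('o, 'a, 'y) bialg_scheme \<Rightarrow> bool" where
  "bialgebra_in C B \<longleftrightarrow> algebra_in C B \<and> coalgebra_in C B \<and>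
     (let U = object B; m = mult B; u = unit B; d = comult B; e = counit B in
       d \<cdot>\<^bsub>C\<^esub> m =
         (m \<otimes>\<^bsub>C\<^esub> m) \<cdot>\<^bsub>C\<^esub> (\<one>\<^bsub>C\<^esub> U \<otimes>\<^bsub>C\<^esub> \<beta>\<^bsub>C\<^esub> U U \<otimes>\<^bsub>C\<^esub> \<one>\<^bsub>C\<^esub> U) \<cdot>\<^bsub>C\<^esub> (d \<otimes>\<^bsub>C\<^esub> d) \<and>
       d \<cdot>\<^bsub>C\<^esub> u = u \<otimes>\<^bsub>C\<^esub> u \<and>
       e \<cdot>\<^bsub>C\<^esub> m = e \<otimes>\<^bsub>C\<^esub> e \<and>
       e \<cdot>\<^bsub>C\<^esub> u = \<one>\<^bsub>C\<^esub> \<I>\<^bsub>C\<^esub>)"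

definition hopf_algebra_in ::
  "('o, 'a, 'z) braided_cat_scheme \<Rightarrow> ('o, 'a, 'y) hopf_alg_scheme \<Rightarrow> bool" where
  "hopf_algebra_in C B \<longleftrightarrow> bialgebra_in C B \<and>
     (let U = object B; m = mult B; u = unit B; d = comult B; e = counit B; S = antipode B in
       S \<in> hom C U U \<and>
       m \<cdot>\<^bsub>C\<^esub> (S \<otimes>\<^bsub>C\<^esub> \<one>\<^bsub>C\<^esub> U) \<cdot>\<^bsub>C\<^esub> d = u \<cdot>\<^bsub>C\<^esub> e \<and>
       m \<cdot>\<^bsub>C\<^esub> (\<one>\<^bsub>C\<^esub> U \<otimes>\<^bsub>C\<^esub> S) \<cdot>\<^bsub>C\<^esub> d = u \<cdot>\<^bsub>C\<^esub> e)"

definition bialgebra_hom ::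
  "('o, 'a, 'z) braided_cat_scheme \<Rightarrow> ('o, 'a, 'x) bialg_scheme \<Rightarrow> ('o, 'a, 'y) bialg_scheme
    \<Rightarrow> 'a \<Rightarrow> bool" where
  "bialgebra_hom C B B' f \<longleftrightarrow>
     f \<in> hom C (object B) (object B') \<and>
     f \<cdot>\<^bsub>C\<^esub> mult B = mult B' \<cdot>\<^bsub>C\<^esub> (f \<otimes>\<^bsub>C\<^esub> f) \<and>
     f \<cdot>\<^bsub>C\<^esub> unit B = unit B' \<and>
     comult B' \<cdot>\<^bsub>C\<^esub> f = (f \<otimes>\<^bsub>C\<^esub> f) \<cdot>\<^bsub>C\<^esub> comult B \<and>
     counit B' \<cdot>\<^bsub>C\<^esub> f = counit B"

definition hopf_algebra_hom ::
  "('o, 'a, 'z) braided_cat_scheme \<Rightarrow> ('o, 'a, 'x) hopf_alg_scheme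
    \<Rightarrow> ('o, 'a, 'y) hopf_alg_scheme \<Rightarrow> 'a \<Rightarrow> bool" where
  "hopf_algebra_hom C B B' f \<longleftrightarrow>
     bialgebra_hom C B B' f \<and> antipode B' \<cdot>\<^bsub>C\<^esub> f = f \<cdot>\<^bsub>C\<^esub> antipode B"

definition bialgebra_iso ::
  "('o, 'a, 'z) braided_cat_scheme \<Rightarrow> ('o, 'a, 'x) bialg_scheme \<Rightarrow> ('o, 'a, 'y) bialg_scheme
    \<Rightarrow> 'a \<Rightarrow> bool" where
  "bialgebra_iso C B B' f \<longleftrightarrow> bialgebra_hom C B B' f \<and>
     (\<exists>g. bialgebra_hom C B' B g \<and> inverse_arrows C (object B) (object B') f g)"

definition hopf_algebra_iso ::
  "('o, 'a, 'z) braided_cat_scheme \<Rightarrow> ('o, 'a, 'x) hopf_alg_scheme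
    \<Rightarrow> ('o, 'a, 'y) hopf_alg_scheme \<Rightarrow> 'a \<Rightarrow> bool" where
  "hopf_algebra_iso C B B' f \<longleftrightarrow> hopf_algebra_hom C B B' f \<and>
     (\<exists>g. hopf_algebra_hom C B' B g \<and> inverse_arrows C (object B) (object B') f g)"


section \<open>The double cross coproduct\<close>

text \<open>
  Only the structure morphisms are defined here. That they form a bialgebra is a property
  of \<open>\<phi>\<close> and \<open>\<psi>\<close>, which have types \<open>A \<rightarrow> H \<boxtimes> A\<close> and \<open>H \<rightarrow> H \<boxtimes> A\<close>.
\<close>

definition double_cross_coproduct ::
  "('o, 'a, 'z) braided_cat_scheme \<Rightarrow> ('o, 'a, 'x) bialg_scheme \<Rightarrow> ('o, 'a, 'y) bialg_scheme
    \<Rightarrow> 'a \<Rightarrow> 'a \<Rightarrow> ('o, 'a) bialg" where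
  "double_cross_coproduct C A H \<phi> \<psi> = (let U = object A; V = object H in
     \<lparr>object = U \<boxtimes>\<^bsub>C\<^esub> V,
      mult = (mult A \<otimes>\<^bsub>C\<^esub> mult H) \<cdot>\<^bsub>C\<^esub> (\<one>\<^bsub>C\<^esub> U \<otimes>\<^bsub>C\<^esub> \<beta>\<^bsub>C\<^esub> V U \<otimes>\<^bsub>C\<^esub> \<one>\<^bsub>C\<^esub> V),
      unit = unit A \<otimes>\<^bsub>C\<^esub> unit H,
      comult =
        (\<one>\<^bsub>C\<^esub> U \<otimes>\<^bsub>C\<^esub> mult H \<otimes>\<^bsub>C\<^esub> mult A \<otimes>\<^bsub>C\<^esub> \<one>\<^bsub>C\<^esub> V) \<cdot>\<^bsub>C\<^esub>
        (\<one>\<^bsub>C\<^esub> U \<otimes>\<^bsub>C\<^esub> \<one>\<^bsub>C\<^esub> V \<otimes>\<^bsub>C\<^esub> \<beta>\<^bsub>C\<^esub> U V \<otimes>\<^bsub>C\<^esub> \<one>\<^bsub>C\<^esub> U \<otimes>\<^bsub>C\<^esub> \<one>\<^bsub>C\<^esub> V) \<cdot>\<^bsub>C\<^esub>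
        (\<one>\<^bsub>C\<^esub> U \<otimes>\<^bsub>C\<^esub> \<phi> \<otimes>\<^bsub>C\<^esub> \<psi> \<otimes>\<^bsub>C\<^esub> \<one>\<^bsub>C\<^esub> V) \<cdot>\<^bsub>C\<^esub>
        (comult A \<otimes>\<^bsub>C\<^esub> comult H),
      counit = counit A \<otimes>\<^bsub>C\<^esub> counit H\<rparr>)"

definition with_antipode :: "('o, 'a) bialg \<Rightarrow> 'a \<Rightarrow> ('o, 'a) hopf_alg" where
  "with_antipode B S =
     \<lparr>object = object B, mult = mult B, unit = unit B,
      comult = comult B, counit = counit B, antipode = S\<rparr>"

end

theory Submission imports Defs begin

text \<open>
  Let \<open>\<theta>\<close> be the inverse of \<open>\<xi> = (p\<^sub>A \<otimes> p\<^sub>H) \<cdot> \<Delta>\<close>. The candidates for the two coactions come from the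
  same construction with the two projections exchanged: put \<open>r = (p\<^sub>H \<otimes> p\<^sub>A) \<cdot> \<Delta>\<close>, of type
  \<open>X \<rightarrow> H \<boxtimes> A\<close>, and let \<open>\<phi>\<close> and \<open>\<psi>\<close> be the restrictions of \<open>r \<cdot> \<theta> : A \<boxtimes> H \<rightarrow> H \<boxtimes> A\<close> along the
  two units, \<open>\<phi> = r \<cdot> \<theta> \<cdot> (\<one> A \<otimes> \<eta>)\<close> and \<open>\<psi> = r \<cdot> \<theta> \<cdot> (\<eta> \<otimes> \<one> H)\<close>.

  Both \<open>\<xi>\<close> and \<open>r\<close> are multiplicative for the braided tensor product algebras
  (\<open>pairing_multiplicative\<close>), because \<open>\<Delta>\<close> is multiplicative and the braiding is natural. Hence
  \<open>\<theta>\<close> and \<open>r \<cdot> \<theta>\<close> are multiplicative, and since \<open>A \<boxtimes> H\<close> is generated by its two factors,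
  \<open>r \<cdot> \<theta>\<close> is recovered from its restrictions as \<open>m \<cdot> (\<phi> \<otimes> \<psi>)\<close>, with \<open>m\<close> the multiplication of
  \<open>H \<boxtimes> A\<close> (\<open>factor_multiplicative\<close>). This turns the comultiplication of the double cross
  coproduct into \<open>(\<one> A \<otimes> r \<cdot> \<theta> \<otimes> \<one> H) \<cdot> (\<Delta>\<^sub>A \<otimes> \<Delta>\<^sub>H)\<close>.

  In Sweedler notation, \<open>\<xi> x = p\<^sub>A x\<^sub>1 \<otimes> p\<^sub>H x\<^sub>2\<close>, and applying \<open>\<Delta>\<^sub>A \<otimes> \<Delta>\<^sub>H\<close> gives
  \<open>p\<^sub>A x\<^sub>1 \<otimes> p\<^sub>A x\<^sub>2 \<otimes> p\<^sub>H x\<^sub>3 \<otimes> p\<^sub>H x\<^sub>4\<close>. The two middle factors are \<open>\<xi> x\<^sub>2\<close> after renumbering, so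
  \<open>r \<cdot> \<theta>\<close> exchanges them and produces \<open>p\<^sub>A x\<^sub>1 \<otimes> p\<^sub>H x\<^sub>2 \<otimes> p\<^sub>A x\<^sub>3 \<otimes> p\<^sub>H x\<^sub>4\<close>, which is
  \<open>(\<xi> \<otimes> \<xi>) (\<Delta> x)\<close> (\<open>comult_pairing\<close>). So \<open>\<xi>\<close> is compatible with all structure morphisms. An
  isomorphism with this property carries every axiom of \<open>X\<close> over to its target
  (\<open>bialgebra_in_transport\<close>), and in the Hopf case, with \<open>S\<close> the antipode of \<open>X\<close>,
  \<open>\<xi> \<cdot> S \<cdot> \<theta>\<close> is an antipode of the target (\<open>hopf_algebra_transport\<close>).
\<close>

section \<open>Typed calculation in a strict tensor category\<close>

context strict_tensor_category
begin

lemma hom_iff: "f \<in> hom C U V \<longleftrightarrow> f \<in> Arr C \<and> Dom C f = U \<and> Cod C f = V"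
  by (auto simp: hom_def)

text \<open>
  Typing facts are stated with \<open>Dom\<close> and \<open>Cod\<close> as functions, so that the simplifier can compute
  the type of a composite; the rules of \<open>category\<close> with \<open>hom\<close> sets would ask it to guess the
  intermediate object.
\<close>

lemma ident_type:
  assumes "U \<in> Obj C"
  shows "\<one> U \<in> Arr C" "Dom C (\<one> U) = U" "Cod C (\<one> U) = U"
  using ident_in_hom[OF assms] by (auto simp: hom_def)

lemma comp_type:
  assumes "f \<in> Arr C" "g \<in> Arr C" "Dom C g = Cod C f"
  shows "g \<cdot> f \<in> Arr C" "Dom C (g \<cdot> f) = Dom C f" "Cod C (g \<cdot> f) = Cod C g"
  using comp_in_hom[of f "Dom C f" "Cod C f" g "Cod C g"] assms by (auto simp: hom_def)

lemma tensor_type: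
  assumes "f \<in> Arr C" "g \<in> Arr C"
  shows "f \<otimes> g \<in> Arr C" "Dom C (f \<otimes> g) = Dom C f \<boxtimes> Dom C g"
    "Cod C (f \<otimes> g) = Cod C f \<boxtimes> Cod C g"
  using tensor_in_hom[of f "Dom C f" "Cod C f" g "Dom C g" "Cod C g"] assms
  by (auto simp: hom_def)

lemmas typing = ident_type comp_type tensor_type dom_in_Obj cod_in_Obj tensor_in_Obj unit_in_Obj
  tensor_obj_assoc unit_tensor_obj tensor_unit_obj

lemma comp_ident_arr: "f \<in> Arr C \<Longrightarrow> Dom C f = U \<Longrightarrow> f \<cdot> \<one> U = f"
  using comp_ident[of f U "Cod C f"] by (auto simp: hom_def)

lemma ident_comp_arr: "f \<in> Arr C \<Longrightarrow> Cod C f = U \<Longrightarrow> \<one> U \<cdot> f = f"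
  using ident_comp[of f "Dom C f" U] by (auto simp: hom_def)

lemma comp_assoc_arr:
  "\<lbrakk>f \<in> Arr C; g \<in> Arr C; h \<in> Arr C; Dom C g = Cod C f; Dom C h = Cod C g\<rbrakk>
    \<Longrightarrow> (h \<cdot> g) \<cdot> f = h \<cdot> g \<cdot> f"
  using comp_assoc[of f "Dom C f" "Cod C f" g "Cod C g" h "Cod C h"] by (auto simp: hom_def)

lemma tensor_comp:
  "\<lbrakk>f \<in> Arr C; f' \<in> Arr C; g \<in> Arr C; g' \<in> Arr C; Dom C f' = Cod C f; Dom C g' = Cod C g\<rbrakk>
    \<Longrightarrow> (f' \<otimes> g') \<cdot> (f \<otimes> g) = (f' \<cdot> f) \<otimes> (g' \<cdot> g)"
  using interchange[of f "Dom C f" "Cod C f" f' "Cod C f'" g "Dom C g" "Cod C g" g' "Cod C g'"]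
  by (auto simp: hom_def)

text \<open>
  Composites are kept nested to the right, which hides the redex of \<open>tensor_comp\<close> unless it is
  the last pair of factors; this variant reaches the others.
\<close>

lemma tensor_comp_tail:
  assumes "f \<in> Arr C" "f' \<in> Arr C" "g \<in> Arr C" "g' \<in> Arr C" "k \<in> Arr C"
    and "Dom C f' = Cod C f" "Dom C g' = Cod C g" "Cod C k = Dom C f \<boxtimes> Dom C g"
  shows "(f' \<otimes> g') \<cdot> (f \<otimes> g) \<cdot> k = ((f' \<cdot> f) \<otimes> (g' \<cdot> g)) \<cdot> k"
proof -
  have "(f' \<otimes> g') \<cdot> (f \<otimes> g) \<cdot> k = ((f' \<otimes> g') \<cdot> (f \<otimes> g)) \<cdot> k"
    using assms by (simp add: comp_assoc_arr typing)
  then show ?thesis using assms by (simp add: tensor_comp)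
qed

lemmas arr_simps = comp_ident_arr ident_comp_arr comp_assoc_arr tensor_comp tensor_comp_tail
  tensor_ident tensor_arr_assoc unit_tensor_arr tensor_unit_arr

lemma comp_eq_tail:
  assumes "f \<cdot> g = h" "f \<in> Arr C" "g \<in> Arr C" "k \<in> Arr C" "Dom C f = Cod C g" "Dom C g = Cod C k"
  shows "f \<cdot> g \<cdot> k = h \<cdot> k"
  using assms comp_assoc_arr[of k g f] by simp

text \<open>
  Coassociativity in the form that isolates the two middle factors of the fourfold
  comultiplication, which is where the exchange of the two projections acts.
\<close>

lemma comult_four:
  assumes "coalgebra_in C B"
  shows "(comult B \<otimes> comult B) \<cdot> comult B =
    (\<one> (object B) \<otimes> comult B \<otimes> \<one> (object B)) \<cdot> (\<one> (object B) \<otimes> comult B) \<cdot> comult B"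
proof -
  define U d where "U = object B" and "d = comult B"
  have [simp]: "U \<in> Obj C" "d \<in> Arr C" "Dom C d = U" "Cod C d = U \<boxtimes> U"
    and coassoc: "(d \<otimes> \<one> U) \<cdot> d = (\<one> U \<otimes> d) \<cdot> d"
    using assms by (auto simp: coalgebra_in_def Let_def hom_def U_def d_def)
  have "(d \<otimes> d) \<cdot> d = (\<one> (U \<boxtimes> U) \<otimes> d) \<cdot> (d \<otimes> \<one> U) \<cdot> d"
    by (simp add: typing arr_simps)
  also have "\<dots> = ((\<one> U \<otimes> \<one> U) \<otimes> d) \<cdot> (\<one> U \<otimes> d) \<cdot> d"
    by (simp add: coassoc tensor_ident)
  also have "\<dots> = (\<one> U \<otimes> ((\<one> U \<otimes> d) \<cdot> d)) \<cdot> d"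
    by (simp add: typing arr_simps del: tensor_ident)
  also have "\<dots> = (\<one> U \<otimes> ((d \<otimes> \<one> U) \<cdot> d)) \<cdot> d"
    by (simp only: coassoc)
  also have "\<dots> = (\<one> U \<otimes> d \<otimes> \<one> U) \<cdot> (\<one> U \<otimes> d) \<cdot> d"
    by (simp add: typing arr_simps)
  finally show ?thesis by (simp add: U_def d_def)
qed

lemma inverse_arrowsD:
  assumes "inverse_arrows C U V f g"
  shows "f \<in> Arr C" "Dom C f = U" "Cod C f = V" "g \<in> Arr C" "Dom C g = V" "Cod C g = U"
    "g \<cdot> f = \<one> U" "f \<cdot> g = \<one> V"
  using assms by (auto simp: inverse_arrows_def hom_def)

lemma comp_iso_cancel:
  assumes "inverse_arrows C U V f g" "h \<in> Arr C" "k \<in> Arr C" "Dom C h = V" "Dom C k = V"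
    and "h \<cdot> f = k \<cdot> f"
  shows "h = k"
proof -
  note [simp] = inverse_arrowsD[OF assms(1)]
  have "h = (h \<cdot> f) \<cdot> g" "k = (k \<cdot> f) \<cdot> g"
    using assms(2-5) by (simp_all add: comp_assoc_arr comp_ident_arr)
  with assms(6) show ?thesis by simp
qed

lemma inverse_ident: "U \<in> Obj C \<Longrightarrow> inverse_arrows C U U (\<one> U) (\<one> U)"
  by (simp add: inverse_arrows_def hom_iff typing comp_ident_arr)

lemma inverse_tensor:
  assumes "inverse_arrows C U V f g" "inverse_arrows C U' V' f' g'"
  shows "inverse_arrows C (U \<boxtimes> U') (V \<boxtimes> V') (f \<otimes> f') (g \<otimes> g')"
proof -
  note [simp] = inverse_arrowsD[OF assms(1)] inverse_arrowsD[OF assms(2)]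
  have "U \<in> Obj C" "V \<in> Obj C" "U' \<in> Obj C" "V' \<in> Obj C"
    using dom_in_Obj[of f] dom_in_Obj[of f'] cod_in_Obj[of f] cod_in_Obj[of f'] by simp_all
  then show ?thesis
    by (simp add: inverse_arrows_def hom_iff typing tensor_comp tensor_ident)
qed

section \<open>Commuting squares\<close>

text \<open>
  A commuting square with vertical sides \<open>a\<close>, \<open>b\<close>, top \<open>f\<close> and bottom \<open>f'\<close>. Squares paste along
  composition and tensor product, so a square over any expression in the structure morphisms
  is assembled by following the shape of that expression.
\<close>

definition intertwines :: "'a \<Rightarrow> 'a \<Rightarrow> 'a \<Rightarrow> 'a \<Rightarrow> bool" where
  "intertwines a b f f' \<longleftrightarrow>
     a \<in> Arr C \<and> b \<in> Arr C \<and> f \<in> hom C (Dom C a) (Dom C b) \<and> f' \<in> hom C (Cod C a) (Cod C b) \<and>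
     f' \<cdot> a = b \<cdot> f"

lemma intertwinesD:
  assumes "intertwines a b f f'"
  shows "a \<in> Arr C" "b \<in> Arr C" "f \<in> Arr C" "Dom C f = Dom C a" "Cod C f = Dom C b"
    "f' \<in> Arr C" "Dom C f' = Cod C a" "Cod C f' = Cod C b" "f' \<cdot> a = b \<cdot> f"
  using assms by (auto simp: intertwines_def hom_iff)

lemma intertwines_ident: "a \<in> Arr C \<Longrightarrow> intertwines a a (\<one> (Dom C a)) (\<one> (Cod C a))"
  by (simp add: intertwines_def hom_iff typing comp_ident_arr ident_comp_arr)

lemma intertwines_comp:
  assumes "intertwines a b f f'" "intertwines b c g g'"
  shows "intertwines a c (g \<cdot> f) (g' \<cdot> f')"
proof -
  note [simp] = intertwinesD(1-8)[OF assms(1)] intertwinesD(1-8)[OF assms(2)]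
  have "(g' \<cdot> f') \<cdot> a = g' \<cdot> b \<cdot> f"
    by (simp add: comp_assoc_arr intertwinesD(9)[OF assms(1)])
  also have "\<dots> = (g' \<cdot> b) \<cdot> f"
    by (simp add: comp_assoc_arr)
  also have "\<dots> = c \<cdot> g \<cdot> f"
    by (simp add: intertwinesD(9)[OF assms(2)] comp_assoc_arr)
  finally show ?thesis
    by (simp add: intertwines_def hom_iff typing)
qed

lemma intertwines_tensor:
  assumes "intertwines a b f f'" "intertwines a' b' g g'"
  shows "intertwines (a \<otimes> a') (b \<otimes> b') (f \<otimes> g) (f' \<otimes> g')"
proof -
  note [simp] = intertwinesD[OF assms(1)] intertwinesD[OF assms(2)]
  show ?thesis
    by (simp add: intertwines_def hom_iff typing tensor_comp)
qed

text \<open>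
  The principle that transports equational axioms: if \<open>f'\<close> and \<open>g'\<close> lie below the same arrow \<open>f\<close>
  and the left side is invertible, both are \<open>b \<cdot> f \<cdot> a'\<close>.
\<close>

lemma intertwines_unique:
  assumes "intertwines a b f f'" "intertwines a b f g'" "inverse_arrows C U V a a'"
  shows "f' = g'"
  using comp_iso_cancel[OF assms(3), of f' g'] intertwinesD[OF assms(1)] intertwinesD[OF assms(2)]
    inverse_arrowsD[OF assms(3)]
  by simp

lemma intertwines_inverse:
  assumes "intertwines a b f f'" "inverse_arrows C U V a a'" "inverse_arrows C U' V' b b'"
  shows "intertwines a' b' f' f"
proof -
  note [simp] = intertwinesD(1-8)[OF assms(1)] inverse_arrowsD[OF assms(2)] inverse_arrowsD[OF assms(3)]
  have "(b' \<cdot> f') \<cdot> a = b' \<cdot> b \<cdot> f"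
    by (simp add: comp_assoc_arr intertwinesD(9)[OF assms(1)] typing)
  also have "\<dots> = (b' \<cdot> b) \<cdot> f"
    by (rule comp_assoc_arr[symmetric]) simp_all
  also have "\<dots> = (f \<cdot> a') \<cdot> a"
    using intertwinesD(4,5)[OF assms(1)] by (simp add: ident_comp_arr comp_ident_arr comp_assoc_arr)
  finally have cancel: "(b' \<cdot> f') \<cdot> a = (f \<cdot> a') \<cdot> a" .
  have "b' \<cdot> f' = f \<cdot> a'"
    by (rule comp_iso_cancel[OF assms(2) _ _ _ _ cancel]) (simp_all add: typing)
  then show ?thesis
    by (simp add: intertwines_def hom_iff)
qed

end

section \<open>Bialgebras and the braided tensor product of algebras\<close>

definition tensor_mult ::
  "('o, 'a, 'z) braided_cat_scheme \<Rightarrow> ('o, 'a, 'x) bialg_scheme \<Rightarrow> ('o, 'a, 'y) bialg_scheme \<Rightarrow> 'a"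
  where "tensor_mult C A B = (mult A \<otimes>\<^bsub>C\<^esub> mult B) \<cdot>\<^bsub>C\<^esub>
    (\<one>\<^bsub>C\<^esub> (object A) \<otimes>\<^bsub>C\<^esub> \<beta>\<^bsub>C\<^esub> (object B) (object A) \<otimes>\<^bsub>C\<^esub> \<one>\<^bsub>C\<^esub> (object B))"

context strict_braided_tensor_category
begin

lemma braiding_type:
  assumes "U \<in> Obj C" "V \<in> Obj C"
  shows "\<beta> U V \<in> Arr C" "Dom C (\<beta> U V) = U \<boxtimes> V" "Cod C (\<beta> U V) = V \<boxtimes> U"
  using braiding_iso[OF assms] by (auto simp: iso_arrow_def inverse_arrows_def hom_def)

lemma braiding_natural_arr:
  "\<lbrakk>f \<in> Arr C; g \<in> Arr C; Cod C f = U; Cod C g = V\<rbrakk>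
    \<Longrightarrow> \<beta> U V \<cdot> (f \<otimes> g) = (g \<otimes> f) \<cdot> \<beta> (Dom C f) (Dom C g)"
  by (rule braiding_natural) (simp_all add: hom_iff)

text \<open>
  The hexagon identity at \<open>\<I>\<close> makes \<open>\<beta> \<I> \<I>\<close> idempotent, and an invertible idempotent is an
  identity.
\<close>

lemma braiding_unit: "\<beta> \<I> \<I> = \<one> \<I>"
proof -
  obtain g where g: "g \<in> Arr C" "Dom C g = \<I>" "Cod C g = \<I>" "g \<cdot> \<beta> \<I> \<I> = \<one> \<I>"
    using braiding_iso[OF unit_in_Obj unit_in_Obj]
    by (auto simp: iso_arrow_def inverse_arrows_def hom_def typing)
  have idem: "\<beta> \<I> \<I> = \<beta> \<I> \<I> \<cdot> \<beta> \<I> \<I>"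
    using hexagon_left[OF unit_in_Obj unit_in_Obj unit_in_Obj]
    by (simp add: typing braiding_type arr_simps)
  have "\<beta> \<I> \<I> = (g \<cdot> \<beta> \<I> \<I>) \<cdot> \<beta> \<I> \<I>"
    by (simp add: g(4) typing braiding_type ident_comp_arr)
  also have "\<dots> = g \<cdot> \<beta> \<I> \<I> \<cdot> \<beta> \<I> \<I>"
    using g(1-3) by (simp only: comp_assoc_arr typing braiding_type)
  also have "\<dots> = \<one> \<I>"
    by (simp only: idem[symmetric] g(4))
  finally show ?thesis .
qed

lemma intertwines_braiding:
  "a \<in> Arr C \<Longrightarrow> b \<in> Arr C \<Longrightarrow>
    intertwines (a \<otimes> b) (b \<otimes> a) (\<beta> (Dom C a) (Dom C b)) (\<beta> (Cod C a) (Cod C b))"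
  by (simp add: intertwines_def hom_iff typing braiding_type braiding_natural_arr)

text \<open>
  The transport of the axioms starts from a target that is only known to be well typed.
\<close>

definition bialgebra_data :: "('o, 'a, 'y) bialg_scheme \<Rightarrow> bool" where
  "bialgebra_data B \<longleftrightarrow> object B \<in> Obj C \<and>
     mult B \<in> hom C (object B \<boxtimes> object B) (object B) \<and> unit B \<in> hom C \<I> (object B) \<and>
     comult B \<in> hom C (object B) (object B \<boxtimes> object B) \<and> counit B \<in> hom C (object B) \<I>"

lemma bialgebra_data: "bialgebra_in C B \<Longrightarrow> bialgebra_data B"
  by (simp add: bialgebra_data_def bialgebra_in_def algebra_in_def coalgebra_in_def Let_def)

lemma bialgebra_types:
  assumes "bialgebra_data B"
  shows "object B \<in> Obj C"
    "mult B \<in> Arr C" "Dom C (mult B) = object B \<boxtimes> object B" "Cod C (mult B) = object B"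
    "unit B \<in> Arr C" "Dom C (unit B) = \<I>" "Cod C (unit B) = object B"
    "comult B \<in> Arr C" "Dom C (comult B) = object B" "Cod C (comult B) = object B \<boxtimes> object B"
    "counit B \<in> Arr C" "Dom C (counit B) = object B" "Cod C (counit B) = \<I>"
  using assms by (auto simp: bialgebra_data_def hom_def)

lemma bialgebra_homD:
  assumes "bialgebra_hom C B B' f"
  shows "f \<in> Arr C" "Dom C f = object B" "Cod C f = object B'"
    "f \<cdot> mult B = mult B' \<cdot> (f \<otimes> f)" "f \<cdot> unit B = unit B'"
    "comult B' \<cdot> f = (f \<otimes> f) \<cdot> comult B" "counit B' \<cdot> f = counit B"
  using assms by (auto simp: bialgebra_hom_def hom_def)

lemma bialgebra_laws:
  assumes "bialgebra_in C B"
  defines "U \<equiv> object B" and "m \<equiv> mult B" and "u \<equiv> unit B" and "d \<equiv> comult B" and "e \<equiv> counit B"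
  shows "m \<cdot> (m \<otimes> \<one> U) = m \<cdot> (\<one> U \<otimes> m)" "m \<cdot> (u \<otimes> \<one> U) = \<one> U" "m \<cdot> (\<one> U \<otimes> u) = \<one> U"
    "(d \<otimes> \<one> U) \<cdot> d = (\<one> U \<otimes> d) \<cdot> d" "(e \<otimes> \<one> U) \<cdot> d = \<one> U" "(\<one> U \<otimes> e) \<cdot> d = \<one> U"
    "d \<cdot> u = u \<otimes> u" "e \<cdot> m = e \<otimes> e" "e \<cdot> u = \<one> \<I>"
  using assms(1) unfolding bialgebra_in_def algebra_in_def coalgebra_in_def Let_def U_def m_def
    u_def d_def e_def
  by blast+

lemma comult_mult:
  assumes "bialgebra_in C B"
  shows "comult B \<cdot> mult B = tensor_mult C B B \<cdot> (comult B \<otimes> comult B)"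
proof -
  note types = bialgebra_types[OF bialgebra_data[OF assms]]
  have "comult B \<cdot> mult B = (mult B \<otimes> mult B) \<cdot>
      (\<one> (object B) \<otimes> \<beta> (object B) (object B) \<otimes> \<one> (object B)) \<cdot> (comult B \<otimes> comult B)"
    using assms unfolding bialgebra_in_def Let_def by blast
  also have "\<dots> = tensor_mult C B B \<cdot> (comult B \<otimes> comult B)"
    by (simp add: tensor_mult_def types typing braiding_type comp_assoc_arr)
  finally show ?thesis .
qed

text \<open>
  All four compatibilities become squares, with an identity of \<open>\<I>\<close> as one side for the unit and
  the counit, so that inverting a morphism and transporting an axiom need no case distinction.
\<close>

lemma bialgebra_hom_iff_intertwines:
  assumes "bialgebra_data B" "bialgebra_data B'"
  shows "bialgebra_hom C B B' f \<longleftrightarrow> f \<in> hom C (object B) (object B') \<and>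
    intertwines (f \<otimes> f) f (mult B) (mult B') \<and> intertwines (\<one> \<I>) f (unit B) (unit B') \<and>
    intertwines f (f \<otimes> f) (comult B) (comult B') \<and> intertwines f (\<one> \<I>) (counit B) (counit B')"
proof -
  note types = bialgebra_types[OF assms(1)] bialgebra_types[OF assms(2)]
  show ?thesis
    by (auto simp: bialgebra_hom_def intertwines_def hom_iff typing types
        comp_ident_arr ident_comp_arr)
qed

lemma tensor_mult_type:
  assumes "bialgebra_data A" "bialgebra_data B"
  shows "tensor_mult C A B \<in> Arr C"
    "Dom C (tensor_mult C A B) = object A \<boxtimes> object B \<boxtimes> object A \<boxtimes> object B"
    "Cod C (tensor_mult C A B) = object A \<boxtimes> object B"
  using bialgebra_types[OF assms(1)] bialgebra_types[OF assms(2)]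
  by (auto simp: tensor_mult_def typing braiding_type)

text \<open>
  The braided tensor product of algebras is functorial: the braiding square of \<open>g\<close> and \<open>f\<close> is
  pasted with the multiplication squares of the two factors.
\<close>

lemma intertwines_tensor_mult:
  assumes data: "bialgebra_data B" "bialgebra_data A" "bialgebra_data B'" "bialgebra_data A'"
    and homs: "bialgebra_hom C B A f" "bialgebra_hom C B' A' g"
  shows "intertwines ((f \<otimes> g) \<otimes> (f \<otimes> g)) (f \<otimes> g) (tensor_mult C B B') (tensor_mult C A A')"
proof -
  note [simp] = bialgebra_homD(1-3)[OF homs(1)] bialgebra_homD(1-3)[OF homs(2)]
  have "intertwines (f \<otimes> (g \<otimes> f) \<otimes> g) (f \<otimes> (f \<otimes> g) \<otimes> g)
      (\<one> (object B) \<otimes> \<beta> (object B') (object B) \<otimes> \<one> (object B'))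
      (\<one> (object A) \<otimes> \<beta> (object A') (object A) \<otimes> \<one> (object A'))"
    using intertwines_ident[of f] intertwines_braiding[of g f] intertwines_ident[of g]
    by (simp add: intertwines_tensor)
  moreover have "intertwines ((f \<otimes> f) \<otimes> (g \<otimes> g)) (f \<otimes> g) (mult B \<otimes> mult B') (mult A \<otimes> mult A')"
    using homs by (simp add: intertwines_tensor bialgebra_hom_iff_intertwines data)
  ultimately show ?thesis
    unfolding tensor_mult_def
    by (intro intertwines_comp) (auto simp: tensor_arr_assoc typing)
qed

section \<open>Pairing two bialgebra morphisms\<close>

text \<open>
  The pairing \<open>(f \<otimes> g) \<cdot> \<Delta>\<close> is a composite of multiplicative maps: \<open>\<Delta>\<close> is one by the bialgebra
  axiom, and \<open>f \<otimes> g\<close> by functoriality of the braided tensor product.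
\<close>

lemma pairing_multiplicative:
  assumes "bialgebra_in C X" "bialgebra_in C A" "bialgebra_in C B"
    and "bialgebra_hom C X A f" "bialgebra_hom C X B g"
    and q: "q = (f \<otimes> g) \<cdot> comult X"
  shows "q \<cdot> mult X = tensor_mult C A B \<cdot> (q \<otimes> q)"
proof -
  note data = assms(1-3)[THEN bialgebra_data]
  note [simp] = bialgebra_types[OF data(1)] bialgebra_types[OF data(2)] bialgebra_types[OF data(3)]
    bialgebra_homD(1-3)[OF assms(4)] bialgebra_homD(1-3)[OF assms(5)]
    tensor_mult_type[OF data(1) data(1)] tensor_mult_type[OF data(2) data(3)]
  let ?d = "comult X"
  have "q \<cdot> mult X = (f \<otimes> g) \<cdot> tensor_mult C X X \<cdot> (?d \<otimes> ?d)"
    by (simp add: q comp_assoc_arr typing comult_mult assms)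
  also have "\<dots> = ((f \<otimes> g) \<cdot> tensor_mult C X X) \<cdot> (?d \<otimes> ?d)"
    by (simp add: comp_assoc_arr typing)
  also have "\<dots> = tensor_mult C A B \<cdot> ((f \<otimes> g) \<otimes> (f \<otimes> g)) \<cdot> (?d \<otimes> ?d)"
    using intertwinesD(9)[OF intertwines_tensor_mult[OF data(1,2,1,3) assms(4,5)]]
    by (simp flip: comp_assoc_arr add: typing)
  also have "((f \<otimes> g) \<otimes> (f \<otimes> g)) \<cdot> (?d \<otimes> ?d) = q \<otimes> q"
    unfolding q by (rule tensor_comp) (simp_all add: typing)
  finally show ?thesis .
qed

text \<open>
  In a tensor product algebra \<open>(a \<otimes> 1) (1 \<otimes> b) = a \<otimes> b\<close>: the braiding only moves the two units
  past each other, where it is trivial. So the two factors generate the product.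
\<close>

lemma tensor_mult_units:
  assumes "bialgebra_in C A" "bialgebra_in C B"
  shows "tensor_mult C A B \<cdot> ((\<one> (object A) \<otimes> unit B) \<otimes> (unit A \<otimes> \<one> (object B)))
    = \<one> (object A \<boxtimes> object B)"
proof -
  note [simp] = bialgebra_types[OF bialgebra_data[OF assms(1)]]
    bialgebra_types[OF bialgebra_data[OF assms(2)]]
  let ?U = "object A" and ?V = "object B"
  note unit_laws = bialgebra_laws(3)[OF assms(1)] bialgebra_laws(2)[OF assms(2)]
  have "(\<one> ?U \<otimes> \<beta> ?V ?U \<otimes> \<one> ?V) \<cdot> ((\<one> ?U \<otimes> unit B) \<otimes> (unit A \<otimes> \<one> ?V)) =
      (\<one> ?U \<otimes> \<beta> ?V ?U \<otimes> \<one> ?V) \<cdot> (\<one> ?U \<otimes> (unit B \<otimes> unit A) \<otimes> \<one> ?V)"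
    by (simp add: typing tensor_arr_assoc)
  also have "\<dots> = \<one> ?U \<otimes> (\<beta> ?V ?U \<cdot> (unit B \<otimes> unit A)) \<otimes> \<one> ?V"
    by (simp add: tensor_comp ident_comp_arr typing braiding_type)
  also have "\<beta> ?V ?U \<cdot> (unit B \<otimes> unit A) = unit A \<otimes> unit B"
    by (simp add: braiding_natural_arr braiding_unit comp_ident_arr typing)
  also have "\<one> ?U \<otimes> (unit A \<otimes> unit B) \<otimes> \<one> ?V = (\<one> ?U \<otimes> unit A) \<otimes> (unit B \<otimes> \<one> ?V)"
    by (simp add: typing tensor_arr_assoc)
  finally have "tensor_mult C A B \<cdot> ((\<one> ?U \<otimes> unit B) \<otimes> (unit A \<otimes> \<one> ?V)) =
      (mult A \<otimes> mult B) \<cdot> ((\<one> ?U \<otimes> unit A) \<otimes> (unit B \<otimes> \<one> ?V))"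
    by (simp add: tensor_mult_def comp_assoc_arr typing braiding_type)
  also have "\<dots> = \<one> ?U \<otimes> \<one> ?V"
    by (subst tensor_comp) (simp_all add: typing unit_laws)
  finally show ?thesis by (simp add: tensor_ident)
qed

section \<open>Transport of structure along an isomorphism\<close>

text \<open>
  Each side of an axiom of the target is the bottom of a square whose top is the same side of that
  axiom in the source. The two squares have equal tops and the same vertical sides, of which the
  left one is invertible, so their bottoms agree.
\<close>

lemma bialgebra_in_transport:
  assumes X: "bialgebra_in C X" and D: "bialgebra_data D"
    and hom: "bialgebra_hom C X D \<xi>"
    and iso: "inverse_arrows C (object X) (object D) \<xi> \<theta>"
  shows "bialgebra_in C D"
proof -
  note data = bialgebra_data[OF X]
  note [simp] = bialgebra_homD(1-3)[OF hom]
  define a b where "a = object X" and "b = object D"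
  note laws = bialgebra_laws[OF X, folded a_def]
  note assoc = tensor_arr_assoc[of \<xi> \<xi> \<xi>, simplified]
  have m: "intertwines (\<xi> \<otimes> \<xi>) \<xi> (mult X) (mult D)"
    and u: "intertwines (\<one> \<I>) \<xi> (unit X) (unit D)"
    and d: "intertwines \<xi> (\<xi> \<otimes> \<xi>) (comult X) (comult D)"
    and e: "intertwines \<xi> (\<one> \<I>) (counit X) (counit D)"
    using hom by (simp_all add: bialgebra_hom_iff_intertwines data D)
  have i: "intertwines \<xi> \<xi> (\<one> a) (\<one> b)"
    using intertwines_ident[of \<xi>] by (simp add: a_def b_def)
  have i0: "intertwines (\<one> \<I>) (\<one> \<I>) (\<one> \<I>) (\<one> \<I>)"
    using intertwines_ident[of "\<one> \<I>"] by (simp add: typing)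
  \<comment> \<open>Tensoring with \<open>\<one> \<I>\<close> is dropped so that squares involving a unit or a counit fit the others.\<close>
  have unit_tensor: "\<one> \<I> \<otimes> \<xi> = \<xi>" "\<xi> \<otimes> \<one> \<I> = \<xi>" "\<one> \<I> \<otimes> \<one> \<I> = \<one> \<I>"
    by (simp_all add: unit_tensor_arr tensor_unit_arr typing)
  have t: "intertwines ((\<xi> \<otimes> \<xi>) \<otimes> (\<xi> \<otimes> \<xi>)) (\<xi> \<otimes> \<xi>) (tensor_mult C X X) (tensor_mult C D D)"
    by (rule intertwines_tensor_mult[OF data D data D hom hom])
  note iso1 = iso[folded a_def b_def]
  note iso2 = inverse_tensor[OF iso1 iso1]
  note iso3 = inverse_tensor[OF iso2 iso1]
  note iso0 = inverse_ident[OF unit_in_Obj]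
  have "mult D \<cdot> (mult D \<otimes> \<one> b) = mult D \<cdot> (\<one> b \<otimes> mult D)"
    using intertwines_unique[OF intertwines_comp[OF intertwines_tensor[OF m i] m]
        intertwines_comp[OF intertwines_tensor[OF i m] m, folded assoc laws(1)] iso3] .
  moreover have "mult D \<cdot> (unit D \<otimes> \<one> b) = \<one> b"
    using intertwines_unique[OF intertwines_comp[OF intertwines_tensor[OF u i] m,
          unfolded unit_tensor laws(2)] i iso1] .
  moreover have "mult D \<cdot> (\<one> b \<otimes> unit D) = \<one> b"
    using intertwines_unique[OF intertwines_comp[OF intertwines_tensor[OF i u] m,
          unfolded unit_tensor laws(3)] i iso1] .
  moreover have "(comult D \<otimes> \<one> b) \<cdot> comult D = (\<one> b \<otimes> comult D) \<cdot> comult D"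
    using intertwines_unique[OF intertwines_comp[OF d intertwines_tensor[OF d i]]
        intertwines_comp[OF d intertwines_tensor[OF i d], folded assoc laws(4)] iso1] .
  moreover have "(counit D \<otimes> \<one> b) \<cdot> comult D = \<one> b"
    using intertwines_unique[OF intertwines_comp[OF d intertwines_tensor[OF e i],
          unfolded unit_tensor laws(5)] i iso1] .
  moreover have "(\<one> b \<otimes> counit D) \<cdot> comult D = \<one> b"
    using intertwines_unique[OF intertwines_comp[OF d intertwines_tensor[OF i e],
          unfolded unit_tensor laws(6)] i iso1] .
  moreover have "comult D \<cdot> mult D = tensor_mult C D D \<cdot> (comult D \<otimes> comult D)"
    using intertwines_unique[OF intertwines_comp[OF m d]
       intertwines_comp[OF intertwines_tensor[OF d d] t, folded comult_mult[OF X]] iso2] .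
  moreover have "comult D \<cdot> unit D = unit D \<otimes> unit D"
    using intertwines_unique[OF intertwines_comp[OF u d]
       intertwines_tensor[OF u u, folded laws(7), unfolded unit_tensor] iso0] .
  moreover have "counit D \<cdot> mult D = counit D \<otimes> counit D"
    using intertwines_unique[OF intertwines_comp[OF m e]
       intertwines_tensor[OF e e, folded laws(8), unfolded unit_tensor] iso2] .
  moreover have "counit D \<cdot> unit D = \<one> \<I>"
    using intertwines_unique[OF intertwines_comp[OF u e, unfolded laws(9)] i0 iso0] .
  moreover have "tensor_mult C D D \<cdot> (comult D \<otimes> comult D) =
      (mult D \<otimes> mult D) \<cdot> (\<one> b \<otimes> \<beta> b b \<otimes> \<one> b) \<cdot> (comult D \<otimes> comult D)"
    by (simp add: tensor_mult_def b_def bialgebra_types[OF D] typing braiding_type comp_assoc_arr)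
  ultimately show ?thesis
    using D
    unfolding bialgebra_in_def algebra_in_def coalgebra_in_def Let_def bialgebra_data_def b_def
    by auto
qed

lemma bialgebra_hom_inverse:
  assumes X: "bialgebra_data X" and D: "bialgebra_data D"
    and hom: "bialgebra_hom C X D \<xi>"
    and iso: "inverse_arrows C (object X) (object D) \<xi> \<theta>"
  shows "bialgebra_hom C D X \<theta>"
proof -
  note iso0 = inverse_ident[OF unit_in_Obj]
  note iso2 = inverse_tensor[OF iso iso]
  have "intertwines (\<xi> \<otimes> \<xi>) \<xi> (mult X) (mult D)" "intertwines (\<one> \<I>) \<xi> (unit X) (unit D)"
    "intertwines \<xi> (\<xi> \<otimes> \<xi>) (comult X) (comult D)" "intertwines \<xi> (\<one> \<I>) (counit X) (counit D)"
    using hom by (simp_all add: bialgebra_hom_iff_intertwines X D)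
  note inverses = this(1)[THEN intertwines_inverse, OF iso2 iso]
    this(2)[THEN intertwines_inverse, OF iso0 iso]
    this(3)[THEN intertwines_inverse, OF iso iso2]
    this(4)[THEN intertwines_inverse, OF iso iso0]
  show ?thesis
    using inverses inverse_arrowsD(4-6)[OF iso]
    by (simp add: bialgebra_hom_iff_intertwines X D hom_iff)
qed

lemma hopf_algebra_bialgebra: "hopf_algebra_in C B \<Longrightarrow> bialgebra_in C B"
  unfolding hopf_algebra_in_def by blast

lemma with_antipode_fields:
  "object (with_antipode B S) = object B" "mult (with_antipode B S) = mult B"
  "unit (with_antipode B S) = unit B" "comult (with_antipode B S) = comult B"
  "counit (with_antipode B S) = counit B" "antipode (with_antipode B S) = S"
  by (simp_all add: with_antipode_def)

lemma bialgebra_with_antipode: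
  "bialgebra_in C (with_antipode B S) \<longleftrightarrow> bialgebra_in C B"
  "bialgebra_hom C B' (with_antipode B S) f \<longleftrightarrow> bialgebra_hom C B' B f"
  "bialgebra_hom C (with_antipode B S) B' f \<longleftrightarrow> bialgebra_hom C B B' f"
  unfolding bialgebra_in_def algebra_in_def coalgebra_in_def bialgebra_hom_def with_antipode_fields
  by (rule refl)+

text \<open>
  Conjugating the antipode of the source by \<open>\<xi>\<close> completes a square below it, so the antipode laws
  transfer like the bialgebra axioms.
\<close>

lemma hopf_algebra_transport:
  assumes X: "hopf_algebra_in C X" and D: "bialgebra_in C D"
    and hom: "bialgebra_hom C X D \<xi>"
    and iso: "inverse_arrows C (object X) (object D) \<xi> \<theta>"
  defines "S \<equiv> \<xi> \<cdot> antipode X \<cdot> \<theta>"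
  shows "hopf_algebra_in C (with_antipode D S)" "hopf_algebra_iso C X (with_antipode D S) \<xi>"
proof -
  note X' = hopf_algebra_bialgebra[OF X]
  note data = bialgebra_data[OF X'] bialgebra_data[OF D]
  define a b where "a = object X" and "b = object D"
  have S_type: "antipode X \<in> Arr C" "Dom C (antipode X) = a" "Cod C (antipode X) = a"
    and antipode: "mult X \<cdot> (antipode X \<otimes> \<one> a) \<cdot> comult X = unit X \<cdot> counit X"
      "mult X \<cdot> (\<one> a \<otimes> antipode X) \<cdot> comult X = unit X \<cdot> counit X"
    using X unfolding hopf_algebra_in_def Let_def hom_iff a_def by blast+
  note iso1 = iso[folded a_def b_def]
  note types = inverse_arrowsD[OF iso1] S_type
  have m: "intertwines (\<xi> \<otimes> \<xi>) \<xi> (mult X) (mult D)"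
    and u: "intertwines (\<one> \<I>) \<xi> (unit X) (unit D)"
    and d: "intertwines \<xi> (\<xi> \<otimes> \<xi>) (comult X) (comult D)"
    and e: "intertwines \<xi> (\<one> \<I>) (counit X) (counit D)"
    using hom by (simp_all add: bialgebra_hom_iff_intertwines data)
  have i: "intertwines \<xi> \<xi> (\<one> a) (\<one> b)"
    using intertwines_ident[of \<xi>] by (simp add: types)
  have s: "intertwines \<xi> \<xi> (antipode X) S"
    by (simp add: intertwines_def hom_iff S_def types comp_assoc_arr comp_ident_arr typing)
  have "mult D \<cdot> (S \<otimes> \<one> b) \<cdot> comult D = unit D \<cdot> counit D"
    using intertwines_unique[OF intertwines_comp[OF intertwines_comp[OF d intertwines_tensor[OF s i]] m]
        intertwines_comp[OF e u, folded antipode(1)] iso1] .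
  moreover have "mult D \<cdot> (\<one> b \<otimes> S) \<cdot> comult D = unit D \<cdot> counit D"
    using intertwines_unique[OF intertwines_comp[OF intertwines_comp[OF d intertwines_tensor[OF i s]] m]
        intertwines_comp[OF e u, folded antipode(2)] iso1] .
  moreover have "S \<in> hom C b b"
    using intertwinesD[OF s] by (simp add: hom_iff types)
  ultimately show "hopf_algebra_in C (with_antipode D S)"
    using D unfolding hopf_algebra_in_def bialgebra_with_antipode with_antipode_fields Let_def b_def
    by blast
  have "antipode X \<cdot> \<theta> = \<theta> \<cdot> S"
    using intertwinesD(9)[OF intertwines_inverse[OF s iso1 iso1]] .
  then show "hopf_algebra_iso C X (with_antipode D S) \<xi>"
    using hom bialgebra_hom_inverse[OF data hom iso] iso intertwinesD(9)[OF s]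
    unfolding hopf_algebra_iso_def hopf_algebra_hom_def bialgebra_with_antipode with_antipode_fields
    by blast
qed

section \<open>The comultiplication of the double cross coproduct\<close>

text \<open>
  Everything between the outer identities multiplies \<open>\<phi>\<close> and \<open>\<psi>\<close> in the algebra \<open>H \<boxtimes> A\<close>, which
  makes results about multiplicative maps into \<open>H \<boxtimes> A\<close> applicable.
\<close>

lemma comult_double_cross_coproduct:
  assumes A: "bialgebra_data A" and H: "bialgebra_data H"
    and \<phi>: "\<phi> \<in> hom C (object A) (object H \<boxtimes> object A)"
    and \<psi>: "\<psi> \<in> hom C (object H) (object H \<boxtimes> object A)"
  shows "comult (double_cross_coproduct C A H \<phi> \<psi>) =
    (\<one> (object A) \<otimes> (tensor_mult C H A \<cdot> (\<phi> \<otimes> \<psi>)) \<otimes> \<one> (object H)) \<cdot> (comult A \<otimes> comult H)"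
proof -
  note [simp] = bialgebra_types[OF A] bialgebra_types[OF H] \<phi>[unfolded hom_iff] \<psi>[unfolded hom_iff]
  let ?U = "object A" and ?V = "object H"
  let ?M = "mult H \<otimes> mult A" and ?K = "\<one> ?V \<otimes> \<beta> ?U ?V \<otimes> \<one> ?U"
  have factors: "\<one> ?U \<otimes> mult H \<otimes> mult A \<otimes> \<one> ?V = \<one> ?U \<otimes> ?M \<otimes> \<one> ?V"
    "\<one> ?U \<otimes> \<one> ?V \<otimes> \<beta> ?U ?V \<otimes> \<one> ?U \<otimes> \<one> ?V = \<one> ?U \<otimes> ?K \<otimes> \<one> ?V"
    "\<one> ?U \<otimes> \<phi> \<otimes> \<psi> \<otimes> \<one> ?V = \<one> ?U \<otimes> (\<phi> \<otimes> \<psi>) \<otimes> \<one> ?V"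
    by (simp_all add: tensor_arr_assoc typing braiding_type)
  show ?thesis
    unfolding double_cross_coproduct_def Let_def factors tensor_mult_def
    by (simp add: tensor_comp tensor_comp_tail comp_ident_arr comp_assoc_arr typing braiding_type)
qed

lemma double_cross_coproduct_data:
  assumes A: "bialgebra_data A" and H: "bialgebra_data H"
    and \<phi>: "\<phi> \<in> hom C (object A) (object H \<boxtimes> object A)"
    and \<psi>: "\<psi> \<in> hom C (object H) (object H \<boxtimes> object A)"
  shows "bialgebra_data (double_cross_coproduct C A H \<phi> \<psi>)"
proof -
  note types = bialgebra_types[OF A] bialgebra_types[OF H] \<phi>[unfolded hom_iff] \<psi>[unfolded hom_iff]
    tensor_mult_type[OF A H] tensor_mult_type[OF H A]
  show ?thesis
    unfolding bialgebra_data_def comult_double_cross_coproduct[OF assms]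
    by (simp add: double_cross_coproduct_def Let_def hom_iff types typing braiding_type)
qed

text \<open>
  A multiplicative map out of \<open>A \<boxtimes> H\<close> is determined by its restrictions to the two factors,
  since \<open>a \<otimes> h = (a \<otimes> 1) (1 \<otimes> h)\<close>; here the map is \<open>r \<cdot> \<theta>\<close>.
\<close>

lemma factor_multiplicative:
  assumes X: "bialgebra_in C X" and A: "bialgebra_in C A" and H: "bialgebra_in C H"
    and r: "r \<in> hom C (object X) (object H \<boxtimes> object A)"
    and r_mult: "r \<cdot> mult X = tensor_mult C H A \<cdot> (r \<otimes> r)"
    and \<theta>: "\<theta> \<in> hom C (object A \<boxtimes> object H) (object X)"
    and \<theta>_mult: "\<theta> \<cdot> tensor_mult C A H = mult X \<cdot> (\<theta> \<otimes> \<theta>)"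
  shows "r \<cdot> \<theta> = tensor_mult C H A \<cdot>
    ((r \<cdot> \<theta> \<cdot> (\<one> (object A) \<otimes> unit H)) \<otimes> (r \<cdot> \<theta> \<cdot> (unit A \<otimes> \<one> (object H))))"
proof -
  note data = bialgebra_data[OF X] bialgebra_data[OF A] bialgebra_data[OF H]
  note [simp] = bialgebra_types[OF data(1)] bialgebra_types[OF data(2)] bialgebra_types[OF data(3)]
    r[unfolded hom_iff] \<theta>[unfolded hom_iff] tensor_mult_type[OF data(2,3)] tensor_mult_type[OF data(3,2)]
  define i j where "i = \<one> (object A) \<otimes> unit H" and "j = unit A \<otimes> \<one> (object H)"
  have [simp]: "i \<in> Arr C" "Dom C i = object A" "Cod C i = object A \<boxtimes> object H"
    "j \<in> Arr C" "Dom C j = object H" "Cod C j = object A \<boxtimes> object H"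
    by (simp_all add: i_def j_def typing)
  have "r \<cdot> \<theta> = r \<cdot> \<theta> \<cdot> tensor_mult C A H \<cdot> (i \<otimes> j)"
    using tensor_mult_units[OF A H] by (simp add: i_def j_def comp_ident_arr)
  also have "\<dots> = r \<cdot> mult X \<cdot> (\<theta> \<otimes> \<theta>) \<cdot> (i \<otimes> j)"
    using comp_eq_tail[OF \<theta>_mult, of "i \<otimes> j"] by (simp add: typing comp_assoc_arr)
  also have "\<dots> = tensor_mult C H A \<cdot> (r \<otimes> r) \<cdot> (\<theta> \<otimes> \<theta>) \<cdot> (i \<otimes> j)"
    using comp_eq_tail[OF r_mult, of "(\<theta> \<otimes> \<theta>) \<cdot> (i \<otimes> j)"] by (simp add: typing comp_assoc_arr)
  also have "\<dots> = tensor_mult C H A \<cdot> ((r \<cdot> \<theta> \<cdot> i) \<otimes> (r \<cdot> \<theta> \<cdot> j))"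
    by (simp add: tensor_comp typing)
  finally show ?thesis by (simp only: i_def j_def)
qed

text \<open>
  On elements, \<open>s\<close> sends \<open>f x\<^sub>1 \<otimes> g x\<^sub>2\<close> to \<open>g x\<^sub>1 \<otimes> f x\<^sub>2\<close>. Both sides are then
  \<open>f x\<^sub>1 \<otimes> g x\<^sub>2 \<otimes> f x\<^sub>3 \<otimes> g x\<^sub>4\<close>: on the left, comultiplying the factors of \<open>\<xi> x\<close> yields
  \<open>f x\<^sub>1 \<otimes> f x\<^sub>2 \<otimes> g x\<^sub>3 \<otimes> g x\<^sub>4\<close>, whose middle is of the form that \<open>s\<close> exchanges.
\<close>

lemma comult_pairing:
  assumes X: "bialgebra_in C X" and A: "bialgebra_in C A" and H: "bialgebra_in C H"
    and f: "bialgebra_hom C X A f" and g: "bialgebra_hom C X H g"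
    and \<xi>: "\<xi> = (f \<otimes> g) \<cdot> comult X"
    and s: "s \<in> hom C (object A \<boxtimes> object H) (object H \<boxtimes> object A)"
    and s_pairing: "s \<cdot> \<xi> = (g \<otimes> f) \<cdot> comult X"
  shows "(\<one> (object A) \<otimes> s \<otimes> \<one> (object H)) \<cdot> (comult A \<otimes> comult H) \<cdot> \<xi> = (\<xi> \<otimes> \<xi>) \<cdot> comult X"
proof -
  note data = bialgebra_data[OF X] bialgebra_data[OF A] bialgebra_data[OF H]
  note [simp] = bialgebra_types[OF data(1)] bialgebra_types[OF data(2)] bialgebra_types[OF data(3)]
    bialgebra_homD(1-3)[OF f] bialgebra_homD(1-3)[OF g] s[unfolded hom_iff]
  let ?x = "\<one> (object X)" and ?d = "comult X"
  let ?S = "\<one> (object A) \<otimes> s \<otimes> \<one> (object H)"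
  have [simp]: "\<xi> \<in> Arr C" "Dom C \<xi> = object X" "Cod C \<xi> = object A \<boxtimes> object H"
    by (simp_all add: \<xi> typing)
  have coalg: "coalgebra_in C X" using X by (simp add: bialgebra_in_def)
  \<comment> \<open>The middle \<open>\<Delta>\<close> of the fourfold comultiplication is absorbed into the middle factor.\<close>
  have regroup: "(f \<otimes> h \<otimes> g) \<cdot> (?x \<otimes> ?d \<otimes> ?x) = f \<otimes> (h \<cdot> ?d) \<otimes> g"
    if "h \<in> Arr C" "Dom C h = object X \<boxtimes> object X" for h
    using that by (simp add: tensor_comp comp_ident_arr typing)
  have "(comult A \<otimes> comult H) \<cdot> \<xi> = ((comult A \<cdot> f) \<otimes> (comult H \<cdot> g)) \<cdot> ?d"
    by (simp add: \<xi> tensor_comp_tail)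
  also have "\<dots> = ((f \<otimes> f) \<otimes> (g \<otimes> g)) \<cdot> (?d \<otimes> ?d) \<cdot> ?d"
    by (subst tensor_comp_tail) (simp_all add: bialgebra_homD(6)[OF f] bialgebra_homD(6)[OF g] typing)
  also have "\<dots> = (f \<otimes> (f \<otimes> g) \<otimes> g) \<cdot> (?x \<otimes> ?d \<otimes> ?x) \<cdot> (?x \<otimes> ?d) \<cdot> ?d"
    by (simp only: comult_four[OF coalg]) (simp add: tensor_arr_assoc typing)
  also have "\<dots> = (f \<otimes> \<xi> \<otimes> g) \<cdot> (?x \<otimes> ?d) \<cdot> ?d"
    by (subst comp_eq_tail[OF regroup]) (simp_all add: \<xi> typing)
  finally have "?S \<cdot> (comult A \<otimes> comult H) \<cdot> \<xi> = ?S \<cdot> (f \<otimes> \<xi> \<otimes> g) \<cdot> (?x \<otimes> ?d) \<cdot> ?d"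
    by simp
  also have "\<dots> = (f \<otimes> ((g \<otimes> f) \<cdot> ?d) \<otimes> g) \<cdot> (?x \<otimes> ?d) \<cdot> ?d"
  proof (rule comp_eq_tail)
    show "?S \<cdot> (f \<otimes> \<xi> \<otimes> g) = f \<otimes> ((g \<otimes> f) \<cdot> ?d) \<otimes> g"
      by (simp add: tensor_comp ident_comp_arr typing s_pairing)
  qed (simp_all add: typing)
  also have "\<dots> = (f \<otimes> (g \<otimes> f) \<otimes> g) \<cdot> (?x \<otimes> ?d \<otimes> ?x) \<cdot> (?x \<otimes> ?d) \<cdot> ?d"
    by (subst comp_eq_tail[OF regroup]) (simp_all add: typing)
  also have "\<dots> = ((f \<otimes> g) \<otimes> (f \<otimes> g)) \<cdot> (?d \<otimes> ?d) \<cdot> ?d"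
    by (simp only: comult_four[OF coalg]) (simp add: tensor_arr_assoc typing)
  also have "\<dots> = (\<xi> \<otimes> \<xi>) \<cdot> ?d"
    unfolding \<xi> by (subst tensor_comp_tail) (simp_all add: typing)
  finally show ?thesis .
qed

text \<open>
  The exchange map of \<open>comult_pairing\<close> is \<open>r \<cdot> \<theta>\<close>. It is multiplicative, hence the product of
  its restrictions \<open>\<phi>\<close> and \<open>\<psi>\<close>, and this product is the inner part of the comultiplication of
  the double cross coproduct.
\<close>

lemma bialgebra_hom_to_double_cross_coproduct:
  assumes X: "bialgebra_in C X" and A: "bialgebra_in C A" and H: "bialgebra_in C H"
    and f: "bialgebra_hom C X A f" and g: "bialgebra_hom C X H g"
    and \<xi>: "\<xi> = (f \<otimes> g) \<cdot> comult X"
    and iso: "inverse_arrows C (object X) (object A \<boxtimes> object H) \<xi> \<theta>"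
  defines "r \<equiv> (g \<otimes> f) \<cdot> comult X"
  defines "\<phi> \<equiv> r \<cdot> \<theta> \<cdot> (\<one> (object A) \<otimes> unit H)" and "\<psi> \<equiv> r \<cdot> \<theta> \<cdot> (unit A \<otimes> \<one> (object H))"
  shows "\<phi> \<in> hom C (object A) (object H \<boxtimes> object A)" "\<psi> \<in> hom C (object H) (object H \<boxtimes> object A)"
    "bialgebra_hom C X (double_cross_coproduct C A H \<phi> \<psi>) \<xi>"
proof -
  note data = bialgebra_data[OF X] bialgebra_data[OF A] bialgebra_data[OF H]
  note types = bialgebra_types[OF data(1)] bialgebra_types[OF data(2)] bialgebra_types[OF data(3)]
    bialgebra_homD(1-3)[OF f] bialgebra_homD(1-3)[OF g] inverse_arrowsD(1-6)[OF iso]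
    tensor_mult_type[OF data(1,1)] tensor_mult_type[OF data(2,3)] tensor_mult_type[OF data(3,2)]
  have r: "r \<in> Arr C" "Dom C r = object X" "Cod C r = object H \<boxtimes> object A"
    by (simp_all add: r_def types typing)
  show \<phi>: "\<phi> \<in> hom C (object A) (object H \<boxtimes> object A)"
    and \<psi>: "\<psi> \<in> hom C (object H) (object H \<boxtimes> object A)"
    by (simp_all add: \<phi>_def \<psi>_def hom_iff types typing r)
  let ?D = "double_cross_coproduct C A H \<phi> \<psi>"
  have fields: "object ?D = object A \<boxtimes> object H" "mult ?D = tensor_mult C A H"
    "unit ?D = unit A \<otimes> unit H" "counit ?D = counit A \<otimes> counit H"
    by (simp_all add: double_cross_coproduct_def tensor_mult_def Let_def)
  have \<xi>_mult: "\<xi> \<cdot> mult X = tensor_mult C A H \<cdot> (\<xi> \<otimes> \<xi>)"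
    by (rule pairing_multiplicative[OF X A H f g \<xi>])
  have r_mult: "r \<cdot> mult X = tensor_mult C H A \<cdot> (r \<otimes> r)"
    by (rule pairing_multiplicative[OF X H A g f r_def[THEN meta_eq_to_obj_eq]])
  have "intertwines (\<xi> \<otimes> \<xi>) \<xi> (mult X) (tensor_mult C A H)"
    by (simp add: intertwines_def hom_iff types typing \<xi>_mult)
  then have "intertwines (\<theta> \<otimes> \<theta>) \<theta> (tensor_mult C A H) (mult X)"
    by (rule intertwines_inverse[OF _ inverse_tensor[OF iso iso] iso])
  note \<theta>_mult = intertwinesD(9)[OF this, symmetric]
  have r\<theta>: "r \<cdot> \<theta> = tensor_mult C H A \<cdot> (\<phi> \<otimes> \<psi>)"
    unfolding \<phi>_def \<psi>_def
    by (rule factor_multiplicative[OF X A H _ r_mult _ \<theta>_mult]) (simp_all add: hom_iff types r)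
  have r\<theta>\<xi>: "(r \<cdot> \<theta>) \<cdot> \<xi> = (g \<otimes> f) \<cdot> comult X"
    using r by (simp add: comp_assoc_arr types inverse_arrowsD[OF iso] comp_ident_arr)
      (simp add: r_def)
  have "\<xi> \<cdot> unit X = (f \<otimes> g) \<cdot> comult X \<cdot> unit X"
    by (simp add: \<xi> comp_assoc_arr types typing)
  also have "\<dots> = (f \<cdot> unit X) \<otimes> (g \<cdot> unit X)"
    by (simp add: bialgebra_laws(7)[OF X] tensor_comp types)
  finally have \<xi>_unit: "\<xi> \<cdot> unit X = unit A \<otimes> unit H"
    by (simp add: bialgebra_homD(5)[OF f] bialgebra_homD(5)[OF g])
  have "(counit A \<otimes> counit H) \<cdot> \<xi> = ((counit A \<cdot> f) \<otimes> (counit H \<cdot> g)) \<cdot> comult X"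
    by (simp add: \<xi> tensor_comp_tail types)
  also have "\<dots> = ((\<one> \<I> \<cdot> counit X) \<otimes> (counit X \<cdot> \<one> (object X))) \<cdot> comult X"
    by (simp add: bialgebra_homD(7)[OF f] bialgebra_homD(7)[OF g] types ident_comp_arr comp_ident_arr)
  also have "\<dots> = (\<one> \<I> \<otimes> counit X) \<cdot> (counit X \<otimes> \<one> (object X)) \<cdot> comult X"
    by (subst tensor_comp_tail) (simp_all add: types typing)
  also have "\<dots> = counit X"
    by (simp add: bialgebra_laws(5)[OF X] unit_tensor_arr comp_ident_arr types)
  finally have \<xi>_counit: "(counit A \<otimes> counit H) \<cdot> \<xi> = counit X" .
  have "comult ?D \<cdot> \<xi> =
      (\<one> (object A) \<otimes> (r \<cdot> \<theta>) \<otimes> \<one> (object H)) \<cdot> (comult A \<otimes> comult H) \<cdot> \<xi>"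
    unfolding comult_double_cross_coproduct[OF data(2,3) \<phi> \<psi>] r\<theta>[symmetric]
    using r by (simp add: comp_assoc_arr types typing)
  also have "\<dots> = (\<xi> \<otimes> \<xi>) \<cdot> comult X"
    by (rule comult_pairing[OF X A H f g \<xi> _ r\<theta>\<xi>]) (simp add: hom_iff types typing r)
  finally have \<xi>_comult: "comult ?D \<cdot> \<xi> = (\<xi> \<otimes> \<xi>) \<cdot> comult X" .
  show "bialgebra_hom C X ?D \<xi>"
    by (simp add: bialgebra_hom_def fields hom_iff types \<xi>_mult \<xi>_unit \<xi>_counit \<xi>_comult)
qed

lemma double_cross_coproduct_of_pairing_iso:
  assumes X: "bialgebra_in C X" and A: "bialgebra_in C A" and H: "bialgebra_in C H"
    and f: "bialgebra_hom C X A f" and g: "bialgebra_hom C X H g"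
    and \<xi>: "\<xi> = (f \<otimes> g) \<cdot> comult X"
    and iso: "iso_arrow C (object X) (object A \<boxtimes> object H) \<xi>"
  obtains \<phi> \<psi> where "\<phi> \<in> hom C (object A) (object H \<boxtimes> object A)"
    "\<psi> \<in> hom C (object H) (object H \<boxtimes> object A)"
    "bialgebra_in C (double_cross_coproduct C A H \<phi> \<psi>)"
    "bialgebra_iso C X (double_cross_coproduct C A H \<phi> \<psi>) \<xi>"
proof -
  obtain \<theta> where \<theta>: "inverse_arrows C (object X) (object A \<boxtimes> object H) \<xi> \<theta>"
    using iso by (auto simp: iso_arrow_def)
  let ?r = "(g \<otimes> f) \<cdot> comult X"
  let ?\<phi> = "?r \<cdot> \<theta> \<cdot> (\<one> (object A) \<otimes> unit H)" and ?\<psi> = "?r \<cdot> \<theta> \<cdot> (unit A \<otimes> \<one> (object H))"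
  let ?D = "double_cross_coproduct C A H ?\<phi> ?\<psi>"
  note hom = bialgebra_hom_to_double_cross_coproduct[OF X A H f g \<xi> \<theta>]
  have D: "bialgebra_data ?D"
    by (rule double_cross_coproduct_data[OF bialgebra_data[OF A] bialgebra_data[OF H] hom(1,2)])
  have \<theta>': "inverse_arrows C (object X) (object ?D) \<xi> \<theta>"
    using \<theta> by (simp add: double_cross_coproduct_def Let_def)
  have "bialgebra_iso C X ?D \<xi>"
    unfolding bialgebra_iso_def
    using hom(3) \<theta>' bialgebra_hom_inverse[OF bialgebra_data[OF X] D hom(3) \<theta>'] by blast
  then show thesis
    using that[OF hom(1,2) bialgebra_in_transport[OF X D hom(3) \<theta>']] by blast
qed

end

theorem theorem1p2:
  fixes C :: "('o, 'a) braided_cat" (structure)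
  assumes "strict_braided_tensor_category C"
  shows
    "(\<forall>(X :: ('o, 'a) bialg) (A :: ('o, 'a) bialg) (H :: ('o, 'a) bialg) p\<^sub>A p\<^sub>H \<xi>.
        bialgebra_in C X \<and> bialgebra_in C A \<and> bialgebra_in C H \<and>
        bialgebra_hom C X A p\<^sub>A \<and> bialgebra_hom C X H p\<^sub>H \<and>
        \<xi> = (p\<^sub>A \<otimes> p\<^sub>H) \<cdot> comult X \<and>
        iso_arrow C (object X) (object A \<boxtimes> object H) \<xi>
        \<longrightarrow> (\<exists>\<phi> \<in> hom C (object A) (object H \<boxtimes> object A).
             \<exists>\<psi> \<in> hom C (object H) (object H \<boxtimes> object A).
               bialgebra_in C (double_cross_coproduct C A H \<phi> \<psi>) \<and>
               bialgebra_iso C X (double_cross_coproduct C A H \<phi> \<psi>) \<xi>)) \<and>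
     (\<forall>(X :: ('o, 'a) hopf_alg) (A :: ('o, 'a) hopf_alg) (H :: ('o, 'a) hopf_alg) p\<^sub>A p\<^sub>H \<xi>.
        hopf_algebra_in C X \<and> hopf_algebra_in C A \<and> hopf_algebra_in C H \<and>
        hopf_algebra_hom C X A p\<^sub>A \<and> hopf_algebra_hom C X H p\<^sub>H \<and>
        \<xi> = (p\<^sub>A \<otimes> p\<^sub>H) \<cdot> comult X \<and>
        iso_arrow C (object X) (object A \<boxtimes> object H) \<xi>
        \<longrightarrow> (\<exists>\<phi> \<in> hom C (object A) (object H \<boxtimes> object A).
             \<exists>\<psi> \<in> hom C (object H) (object H \<boxtimes> object A).
             \<exists>S. hopf_algebra_in C (with_antipode (double_cross_coproduct C A H \<phi> \<psi>) S) \<and>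
                 hopf_algebra_iso C X (with_antipode (double_cross_coproduct C A H \<phi> \<psi>) S) \<xi>))"
proof -
  interpret strict_braided_tensor_category C by (rule assms)
  show ?thesis
  proof (intro conjI allI impI; elim conjE)
    fix X A H :: "('o, 'a) bialg" and p\<^sub>A p\<^sub>H \<xi>
    assume asm: "bialgebra_in C X" "bialgebra_in C A" "bialgebra_in C H"
      "bialgebra_hom C X A p\<^sub>A" "bialgebra_hom C X H p\<^sub>H" "\<xi> = (p\<^sub>A \<otimes> p\<^sub>H) \<cdot> comult X"
      "iso_arrow C (object X) (object A \<boxtimes> object H) \<xi>"
    from double_cross_coproduct_of_pairing_iso[OF this]
    show "\<exists>\<phi> \<in> hom C (object A) (object H \<boxtimes> object A).
             \<exists>\<psi> \<in> hom C (object H) (object H \<boxtimes> object A).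
               bialgebra_in C (double_cross_coproduct C A H \<phi> \<psi>) \<and>
               bialgebra_iso C X (double_cross_coproduct C A H \<phi> \<psi>) \<xi>"
      by blast
  next
    fix X A H :: "('o, 'a) hopf_alg" and p\<^sub>A p\<^sub>H \<xi>
    assume X: "hopf_algebra_in C X" and AH: "hopf_algebra_in C A" "hopf_algebra_in C H"
      and p: "hopf_algebra_hom C X A p\<^sub>A" "hopf_algebra_hom C X H p\<^sub>H"
      and \<xi>: "\<xi> = (p\<^sub>A \<otimes> p\<^sub>H) \<cdot> comult X" "iso_arrow C (object X) (object A \<boxtimes> object H) \<xi>"
    obtain \<phi> \<psi> where \<phi>\<psi>: "\<phi> \<in> hom C (object A) (object H \<boxtimes> object A)"
        "\<psi> \<in> hom C (object H) (object H \<boxtimes> object A)"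
      and D: "bialgebra_in C (double_cross_coproduct C A H \<phi> \<psi>)"
        "bialgebra_iso C X (double_cross_coproduct C A H \<phi> \<psi>) \<xi>"
      by (rule double_cross_coproduct_of_pairing_iso[of X A H p\<^sub>A p\<^sub>H \<xi>])
        (use X AH p \<xi> in \<open>unfold hopf_algebra_hom_def, blast intro: hopf_algebra_bialgebra\<close>)+
    from D(2) obtain \<theta> where "bialgebra_hom C X (double_cross_coproduct C A H \<phi> \<psi>) \<xi>"
      and "inverse_arrows C (object X) (object (double_cross_coproduct C A H \<phi> \<psi>)) \<xi> \<theta>"
      by (auto simp: bialgebra_iso_def)
    from hopf_algebra_transport[OF X D(1) this] \<phi>\<psi>
    show "\<exists>\<phi> \<in> hom C (object A) (object H \<boxtimes> object A).
             \<exists>\<psi> \<in> hom C (object H) (object H \<boxtimes> object A).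
             \<exists>S. hopf_algebra_in C (with_antipode (double_cross_coproduct C A H \<phi> \<psi>) S) \<and>
                 hopf_algebra_iso C X (with_antipode (double_cross_coproduct C A H \<phi> \<psi>) S) \<xi>"
      by blast
  qed
qed

end
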